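(* Let $(\varphi,\xi,\eta,g)$ be a para-Kenmotsu structure on the $(2n+1)$-dimensional manifold $M$, let $(g,\xi,\lambda,\mu)$ be an $\eta$-Ricci soliton on $M$, and suppose that $(\xi,\cdot)_{S}\cdot W_2=0$, i.e. $$S(X,W_2(Y,Z)V)\xi-S(\xi,W_2(Y,Z)V)X+S(X,Y)W_2(\xi,Z)V-S(\xi,Y)W_2(X,Z)V$$ $$+S(X,Z)W_2(Y,\xi)V-S(\xi,Z)W_2(Y,X)V+S(X,V)W_2(Y,Z)\xi-S(\xi,V)W_2(Y,Z)X=0$$ for all vector fields $X,Y,Z,V$ on $M$. Then either $\mu=1$ and $\lambda=2n-1$, or $\mu=2n+1$ and $\lambda=-1$.
   Context: Here $n\geq 1$. An almost paracontact metric structure on a $(2n+1)$-dimensional smooth manifold $M$ is $(\varphi,\xi,\eta,g)$, where $\varphi$ is a $(1,1)$-tensor field, $\xi$ a vector field, $\eta$ a $1$-form and $g$ a pseudo-Riemannian metric of signature $(n+1,n)$, such that: (1) $\varphi\xi=0$, $\eta\circ\varphi=0$; (2) $\eta(\xi)=1$, $\varphi^2=I-\eta\otimes\xi$; (3) $\varphi$ induces on the $2n$-dimensional distribution $\mathcal{D}=\ker\eta$ an almost paracomplex structure $P$, i.e. $P^2=I$ on $\mathcal{D}$ and the eigensubbundles of $P$ for the eigenvalues $1$ and $-1$ both have rank $n$; (4) $g(\varphi X,\varphi Y)=-g(X,Y)+\eta(X)\eta(Y)$ for all vector fields $X,Y$. It follows that $\eta(X)=g(X,\xi)$. The structure is para-Kenmotsu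 if the Levi-Civita connection $\nabla$ of $g$ satisfies $(\nabla_X\varphi)Y=g(\varphi X,Y)\xi-\eta(Y)\varphi X$ for all vector fields $X,Y$. $R(X,Y)Z=\nabla_X\nabla_YZ-\nabla_Y\nabla_XZ-\nabla_{[X,Y]}Z$ is the Riemann curvature tensor, $S(Y,Z)=\operatorname{trace}(X\mapsto R(X,Y)Z)$ is the Ricci curvature tensor of $g$, $Q$ is the Ricci operator defined by $g(QX,Y)=S(X,Y)$, and $L_\xi$ is the Lie derivative along $\xi$. The $W_2$-curvature tensor field is $W_2(X,Y)Z:=R(X,Y)Z+\frac{1}{2n}[g(X,Z)QY-g(Y,Z)QX]$. The data $(g,\xi,\lambda,\mu)$, with $\lambda,\mu$ real constants, is an $\eta$-Ricci soliton on $M$ if $L_{\xi}g+2S+2\lambda g+2\mu\,\eta\otimes\eta=0$. *)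

theory Defs
  imports "HOL-Analysis.Analysis"
begin

section \<open>Smooth maps between open subsets of Euclidean spaces\<close>

text \<open>Meant for open \<open>U\<close>. For a finite-dimensional domain, a differentiable map is of class
  \<open>C\<^sup>k\<^sup>+\<^sup>1\<close> iff each of its directional derivatives is of class \<open>C\<^sup>k\<close>.\<close>

primrec Ck_on :: "nat \<Rightarrow> 'e::euclidean_space set \<Rightarrow> ('e \<Rightarrow> 'b::real_normed_vector) \<Rightarrow> bool" where
  "Ck_on 0 U f \<longleftrightarrow> continuous_on U f"
| "Ck_on (Suc k) U f \<longleftrightarrow>
     f differentiable_on U \<and> (\<forall>v. Ck_on k U (\<lambda>x. frechet_derivative f (at x) v))"

definition smooth_on :: "'e::euclidean_space set \<Rightarrow> ('e \<Rightarrow> 'b::real_normed_vector) \<Rightarrow> bool" where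
  "smooth_on U f \<longleftrightarrow> (\<forall>k. Ck_on k U f)"


section \<open>Smooth manifolds\<close>

text \<open>A chart is a pair \<open>(U, h)\<close> of an open domain and a coordinate map, of which only the
  restriction to \<open>U\<close> matters.\<close>

type_synonym ('a, 'm) chart = "'a set \<times> ('a \<Rightarrow> real ^ 'm)"

definition chart_inv :: "('a, 'm) chart \<Rightarrow> real ^ 'm \<Rightarrow> 'a" where
  "chart_inv c = inv_into (fst c) (snd c)"

definition chart_range :: "('a, 'm) chart \<Rightarrow> (real ^ 'm) set" where
  "chart_range c = snd c ` fst c"

definition is_chart :: "'a topology \<Rightarrow> ('a, 'm::finite) chart \<Rightarrow> bool" where
  "is_chart X c \<longleftrightarrow>
     openin X (fst c) \<and> open (chart_range c) \<and>
     homeomorphic_map (subtopology X (fst c)) (top_of_set (chart_range c)) (snd c)"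

definition points :: "('a, 'm) chart set \<Rightarrow> 'a set" where
  "points A = \<Union> (fst ` A)"

text \<open>A nonempty smooth manifold of dimension \<open>CARD('m)\<close>, with underlying space \<open>X\<close> and smooth
  structure given by the (not necessarily maximal) atlas \<open>A\<close>.\<close>

definition smooth_manifold :: "'a topology \<Rightarrow> ('a, 'm::finite) chart set \<Rightarrow> bool" where
  "smooth_manifold X A \<longleftrightarrow>
     Hausdorff_space X \<and> second_countable X \<and> topspace X \<noteq> {} \<and>
     (\<forall>c\<in>A. is_chart X c) \<and> points A = topspace X \<and>
     (\<forall>c\<in>A. \<forall>c'\<in>A. smooth_on (snd c ` (fst c \<inter> fst c')) (\<lambda>x. snd c' (chart_inv c x)))"


section \<open>Tangent vectors, vector fields and tensor fields\<close>

text \<open>The tangent space at every point \<open>p\<close> is modelled as \<^typ>\<open>real ^ 'm\<close> by means of a chart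
  \<open>pref A p\<close> around \<open>p\<close> chosen once and for all: \<open>v\<close> stands for the tangent vector at \<open>p\<close> with
  components \<open>v\<close> in that chart. Tensors at \<open>p\<close> are (multi)linear maps on \<^typ>\<open>real ^ 'm\<close>. As the
  chosen charts of neighbouring points are unrelated, smoothness of a field is not smoothness
  of \<open>p \<mapsto> X p\<close>, but is expressed by its components in each fixed chart of the atlas.\<close>

definition pref :: "('a, 'm) chart set \<Rightarrow> 'a \<Rightarrow> ('a, 'm) chart" where
  "pref A p = (SOME c. c \<in> A \<and> p \<in> fst c)"

text \<open>The differential at \<open>p\<close> of a map from the manifold to a normed space. For a function \<open>f\<close>
  and a vector field \<open>X\<close>, \<open>mderiv A f p (X p)\<close> is \<open>(X f)(p)\<close>; for a chart \<open>c\<close> around \<open>p\<close>,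
  \<open>mderiv A (snd c) p v\<close> is the tuple of components of the tangent vector \<open>v\<close> in the chart \<open>c\<close>.\<close>

definition mderiv ::
  "('a, 'm::finite) chart set \<Rightarrow> ('a \<Rightarrow> 'b::real_normed_vector) \<Rightarrow> 'a \<Rightarrow> real ^ 'm \<Rightarrow> 'b" where
  "mderiv A f p v =
     frechet_derivative (\<lambda>x. f (chart_inv (pref A p) x)) (at (snd (pref A p) p)) v"

text \<open>Conversely, the tangent vector at \<open>p\<close> whose components in the chart \<open>c\<close> are \<open>v\<close>.\<close>

definition chart_vector ::
  "('a, 'm::finite) chart set \<Rightarrow> ('a, 'm) chart \<Rightarrow> 'a \<Rightarrow> real ^ 'm \<Rightarrow> real ^ 'm" where
  "chart_vector A c p v =
     frechet_derivative (\<lambda>x. snd (pref A p) (chart_inv c x)) (at (snd c p)) v"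

definition smooth_fun ::
  "('a, 'm::finite) chart set \<Rightarrow> ('a \<Rightarrow> real) \<Rightarrow> bool" where
  "smooth_fun A f \<longleftrightarrow> (\<forall>c\<in>A. smooth_on (chart_range c) (\<lambda>x. f (chart_inv c x)))"

type_synonym ('a, 'm) vfield = "'a \<Rightarrow> real ^ 'm"

definition vector_field :: "('a, 'm::finite) chart set \<Rightarrow> ('a, 'm) vfield \<Rightarrow> bool" where
  "vector_field A X \<longleftrightarrow>
     (\<forall>c\<in>A. smooth_on (chart_range c)
        (\<lambda>x. let p = chart_inv c x in mderiv A (snd c) p (X p)))"

definition one_form ::
  "('a, 'm::finite) chart set \<Rightarrow> ('a \<Rightarrow> real ^ 'm \<Rightarrow> real) \<Rightarrow> bool" where
  "one_form A \<eta> \<longleftrightarrow>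
     (\<forall>p\<in>points A. linear (\<eta> p)) \<and>
     (\<forall>c\<in>A. \<forall>v. smooth_on (chart_range c)
        (\<lambda>x. let p = chart_inv c x in \<eta> p (chart_vector A c p v)))"

definition endomorphism_field ::
  "('a, 'm::finite) chart set \<Rightarrow> ('a \<Rightarrow> real ^ 'm \<Rightarrow> real ^ 'm) \<Rightarrow> bool" where
  "endomorphism_field A \<phi> \<longleftrightarrow>
     (\<forall>p\<in>points A. linear (\<phi> p)) \<and>
     (\<forall>c\<in>A. \<forall>v. smooth_on (chart_range c)
        (\<lambda>x. let p = chart_inv c x in mderiv A (snd c) p (\<phi> p (chart_vector A c p v))))"

type_synonym ('a, 'm) bilinear_field = "'a \<Rightarrow> real ^ 'm \<Rightarrow> real ^ 'm \<Rightarrow> real"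

definition smooth_bilinear_field ::
  "('a, 'm::finite) chart set \<Rightarrow> ('a, 'm) bilinear_field \<Rightarrow> bool" where
  "smooth_bilinear_field A b \<longleftrightarrow>
     (\<forall>p\<in>points A. bilinear (b p)) \<and>
     (\<forall>c\<in>A. \<forall>v w. smooth_on (chart_range c)
        (\<lambda>x. let p = chart_inv c x in b p (chart_vector A c p v) (chart_vector A c p w)))"

text \<open>Signature \<open>(r, s)\<close>: there is a basis orthonormal with respect to \<open>b\<close>, consisting of
  \<open>r\<close> vectors of square \<open>1\<close> and \<open>s\<close> vectors of square \<open>-1\<close> (their linear independence being
  automatic).\<close>

definition has_signature ::
  "('v::real_vector \<Rightarrow> 'v \<Rightarrow> real) \<Rightarrow> nat \<Rightarrow> nat \<Rightarrow> bool" where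
  "has_signature b r s \<longleftrightarrow>
     (\<exists>e :: nat \<Rightarrow> 'v. span (e ` {..<r + s}) = UNIV \<and>
        (\<forall>i<r + s. \<forall>j<r + s.
           b (e i) (e j) = (if i \<noteq> j then 0 else if i < r then 1 else - 1)))"

definition pseudo_riemannian_metric ::
  "('a, 'm::finite) chart set \<Rightarrow> nat \<Rightarrow> nat \<Rightarrow> ('a, 'm) bilinear_field \<Rightarrow> bool" where
  "pseudo_riemannian_metric A r s g \<longleftrightarrow>
     smooth_bilinear_field A g \<and>
     (\<forall>p\<in>points A. (\<forall>v w. g p v w = g p w v) \<and> has_signature (g p) r s)"


section \<open>Connections and curvature\<close>

text \<open>The coordinate formula \<open>[X, Y]\<^sup>k = X\<^sup>i \<partial>\<^sub>i Y\<^sup>k - Y\<^sup>i \<partial>\<^sub>i X\<^sup>k\<close>, evaluated at \<open>p\<close> in the chart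
  \<open>pref A p\<close>; there, \<open>X p\<close> and \<open>Y p\<close> are themselves the tuples of components.\<close>

definition lie_bracket ::
  "('a, 'm::finite) chart set \<Rightarrow> ('a, 'm) vfield \<Rightarrow> ('a, 'm) vfield \<Rightarrow> ('a, 'm) vfield" where
  "lie_bracket A X Y p =
     mderiv A (\<lambda>q. mderiv A (snd (pref A p)) q (Y q)) p (X p) -
     mderiv A (\<lambda>q. mderiv A (snd (pref A p)) q (X q)) p (Y p)"

type_synonym ('a, 'm) connection = "('a, 'm) vfield \<Rightarrow> ('a, 'm) vfield \<Rightarrow> ('a, 'm) vfield"

definition affine_connection ::
  "('a, 'm::finite) chart set \<Rightarrow> ('a, 'm) connection \<Rightarrow> bool" where
  "affine_connection A D \<longleftrightarrow>
     (\<forall>X Y. vector_field A X \<longrightarrow> vector_field A Y \<longrightarrow> vector_field A (D X Y)) \<and>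
     (\<forall>X X' Y. vector_field A X \<longrightarrow> vector_field A X' \<longrightarrow> vector_field A Y \<longrightarrow>
        (\<forall>p\<in>points A. D (\<lambda>q. X q + X' q) Y p = D X Y p + D X' Y p)) \<and>
     (\<forall>f X Y. smooth_fun A f \<longrightarrow> vector_field A X \<longrightarrow> vector_field A Y \<longrightarrow>
        (\<forall>p\<in>points A. D (\<lambda>q. f q *\<^sub>R X q) Y p = f p *\<^sub>R D X Y p)) \<and>
     (\<forall>X Y Y'. vector_field A X \<longrightarrow> vector_field A Y \<longrightarrow> vector_field A Y' \<longrightarrow>
        (\<forall>p\<in>points A. D X (\<lambda>q. Y q + Y' q) p = D X Y p + D X Y' p)) \<and>
     (\<forall>f X Y. smooth_fun A f \<longrightarrow> vector_field A X \<longrightarrow> vector_field A Y \<longrightarrow>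
        (\<forall>p\<in>points A. D X (\<lambda>q. f q *\<^sub>R Y q) p =
           mderiv A f p (X p) *\<^sub>R Y p + f p *\<^sub>R D X Y p))"

definition levi_civita_connection ::
  "('a, 'm::finite) chart set \<Rightarrow> ('a, 'm) bilinear_field \<Rightarrow> ('a, 'm) connection \<Rightarrow> bool" where
  "levi_civita_connection A g D \<longleftrightarrow>
     affine_connection A D \<and>
     (\<forall>X Y. vector_field A X \<longrightarrow> vector_field A Y \<longrightarrow>
        (\<forall>p\<in>points A. D X Y p - D Y X p = lie_bracket A X Y p)) \<and>
     (\<forall>X Y Z. vector_field A X \<longrightarrow> vector_field A Y \<longrightarrow> vector_field A Z \<longrightarrow>
        (\<forall>p\<in>points A. mderiv A (\<lambda>q. g q (Y q) (Z q)) p (X p) =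
           g p (D X Y p) (Z p) + g p (Y p) (D X Z p)))"

definition curvature ::
  "('a, 'm::finite) chart set \<Rightarrow> ('a, 'm) connection \<Rightarrow>
   ('a, 'm) vfield \<Rightarrow> ('a, 'm) vfield \<Rightarrow> ('a, 'm) vfield \<Rightarrow> ('a, 'm) vfield" where
  "curvature A D X Y Z p = D X (D Y Z) p - D Y (D X Z) p - D (lie_bracket A X Y) Z p"

text \<open>Since \<open>R(X, Y)Z\<close> at \<open>p\<close> depends on \<open>X\<close> only through \<open>X p\<close>, the endomorphism \<open>X \<mapsto> R(X, Y)Z\<close>
  of the tangent space at \<open>p\<close> is computed by extending tangent vectors to vector fields in an
  arbitrary way.\<close>

definition field_through ::
  "('a, 'm::finite) chart set \<Rightarrow> 'a \<Rightarrow> real ^ 'm \<Rightarrow> ('a, 'm) vfield" where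
  "field_through A p v = (SOME X. vector_field A X \<and> X p = v)"

definition ricci ::
  "('a, 'm::finite) chart set \<Rightarrow> ('a, 'm) connection \<Rightarrow>
   ('a, 'm) vfield \<Rightarrow> ('a, 'm) vfield \<Rightarrow> 'a \<Rightarrow> real" where
  "ricci A D Y Z p = trace (matrix (\<lambda>v. curvature A D (field_through A p v) Y Z p))"

text \<open>\<open>Q\<close> with \<open>g(QX, Y) = S(X, Y)\<close> for all \<open>Y\<close>, which is unique as \<open>g\<close> is nondegenerate.\<close>

definition ricci_operator ::
  "('a, 'm::finite) chart set \<Rightarrow> ('a, 'm) bilinear_field \<Rightarrow> ('a, 'm) connection \<Rightarrow>
   ('a, 'm) vfield \<Rightarrow> ('a, 'm) vfield" where
  "ricci_operator A g D X p =
     (THE w. \<forall>Y. vector_field A Y \<longrightarrow> g p w (Y p) = ricci A D X Y p)"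

definition W2_curvature ::
  "nat \<Rightarrow> ('a, 'm::finite) chart set \<Rightarrow> ('a, 'm) bilinear_field \<Rightarrow> ('a, 'm) connection \<Rightarrow>
   ('a, 'm) vfield \<Rightarrow> ('a, 'm) vfield \<Rightarrow> ('a, 'm) vfield \<Rightarrow> ('a, 'm) vfield" where
  "W2_curvature n A g D X Y Z p =
     curvature A D X Y Z p +
     (1 / (2 * real n)) *\<^sub>R
       (g p (X p) (Z p) *\<^sub>R ricci_operator A g D Y p -
        g p (Y p) (Z p) *\<^sub>R ricci_operator A g D X p)"

definition lie_derivative_bilinear ::
  "('a, 'm::finite) chart set \<Rightarrow> ('a, 'm) vfield \<Rightarrow> ('a, 'm) bilinear_field \<Rightarrow>
   ('a, 'm) vfield \<Rightarrow> ('a, 'm) vfield \<Rightarrow> 'a \<Rightarrow> real" where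
  "lie_derivative_bilinear A V b X Y p =
     mderiv A (\<lambda>q. b q (X q) (Y q)) p (V p) -
     b p (lie_bracket A V X p) (Y p) - b p (X p) (lie_bracket A V Y p)"


section \<open>Para-Kenmotsu structures and eta-Ricci solitons\<close>

definition almost_paracomplex ::
  "nat \<Rightarrow> (real ^ 'm::finite) set \<Rightarrow> (real ^ 'm \<Rightarrow> real ^ 'm) \<Rightarrow> bool" where
  "almost_paracomplex n D P \<longleftrightarrow>
     P ` D \<subseteq> D \<and> (\<forall>v\<in>D. P (P v) = v) \<and>
     dim {v\<in>D. P v = v} = n \<and> dim {v\<in>D. P v = - v} = n"

definition almost_paracontact_metric ::
  "nat \<Rightarrow> ('a, 'm::finite) chart set \<Rightarrow> ('a \<Rightarrow> real ^ 'm \<Rightarrow> real ^ 'm) \<Rightarrow>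
   ('a, 'm) vfield \<Rightarrow> ('a \<Rightarrow> real ^ 'm \<Rightarrow> real) \<Rightarrow> ('a, 'm) bilinear_field \<Rightarrow> bool" where
  "almost_paracontact_metric n A \<phi> \<xi> \<eta> g \<longleftrightarrow>
     endomorphism_field A \<phi> \<and> vector_field A \<xi> \<and> one_form A \<eta> \<and>
     pseudo_riemannian_metric A (n + 1) n g \<and>
     (\<forall>p\<in>points A.
        \<phi> p (\<xi> p) = 0 \<and> (\<forall>v. \<eta> p (\<phi> p v) = 0) \<and>
        \<eta> p (\<xi> p) = 1 \<and> (\<forall>v. \<phi> p (\<phi> p v) = v - \<eta> p v *\<^sub>R \<xi> p) \<and>
        almost_paracomplex n {v. \<eta> p v = 0} (\<phi> p)) \<and>
     (\<forall>X Y. vector_field A X \<longrightarrow> vector_field A Y \<longrightarrow>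
        (\<forall>p\<in>points A. g p (\<phi> p (X p)) (\<phi> p (Y p)) =
           - g p (X p) (Y p) + \<eta> p (X p) * \<eta> p (Y p)))"

text \<open>\<open>D\<close> is to be the Levi-Civita connection of \<open>g\<close>; \<open>(\<nabla>\<^sub>X \<phi>) Y = \<nabla>\<^sub>X (\<phi> Y) - \<phi> (\<nabla>\<^sub>X Y)\<close>.\<close>

definition para_kenmotsu ::
  "nat \<Rightarrow> ('a, 'm::finite) chart set \<Rightarrow> ('a \<Rightarrow> real ^ 'm \<Rightarrow> real ^ 'm) \<Rightarrow>
   ('a, 'm) vfield \<Rightarrow> ('a \<Rightarrow> real ^ 'm \<Rightarrow> real) \<Rightarrow> ('a, 'm) bilinear_field \<Rightarrow>
   ('a, 'm) connection \<Rightarrow> bool" where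
  "para_kenmotsu n A \<phi> \<xi> \<eta> g D \<longleftrightarrow>
     almost_paracontact_metric n A \<phi> \<xi> \<eta> g \<and>
     (\<forall>X Y. vector_field A X \<longrightarrow> vector_field A Y \<longrightarrow>
        (\<forall>p\<in>points A. D X (\<lambda>q. \<phi> q (Y q)) p - \<phi> p (D X Y p) =
           g p (\<phi> p (X p)) (Y p) *\<^sub>R \<xi> p - \<eta> p (Y p) *\<^sub>R \<phi> p (X p)))"

definition eta_ricci_soliton ::
  "('a, 'm::finite) chart set \<Rightarrow> ('a \<Rightarrow> real ^ 'm \<Rightarrow> real) \<Rightarrow> ('a, 'm) connection \<Rightarrow>
   ('a, 'm) bilinear_field \<Rightarrow> ('a, 'm) vfield \<Rightarrow> real \<Rightarrow> real \<Rightarrow> bool" where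
  "eta_ricci_soliton A \<eta> D g \<xi> l m \<longleftrightarrow>
     (\<forall>X Y. vector_field A X \<longrightarrow> vector_field A Y \<longrightarrow>
        (\<forall>p\<in>points A.
           lie_derivative_bilinear A \<xi> g X Y p + 2 * ricci A D X Y p +
           2 * l * g p (X p) (Y p) + 2 * m * (\<eta> p (X p) * \<eta> p (Y p)) = 0))"

end

theory Submission
  imports Defs "HOL-Real_Asymp.Real_Asymp"
begin

text \<open>The para-Kenmotsu condition gives \<open>\<nabla>\<^sub>X \<xi> = X - \<eta>(X) \<xi>\<close>. So \<open>L\<^sub>\<xi> g = 2 (g - \<eta> \<otimes> \<eta>)\<close>, and the
  soliton equation determines the Ricci tensor: \<open>S = - (\<lambda> + 1) g - (\<mu> - 1) \<eta> \<otimes> \<eta>\<close>. From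
  \<open>R(X, \<xi>)\<xi> = \<eta>(X) \<xi> - X\<close> one gets \<open>S(\<xi>, \<xi>) = - 2n\<close>, that is, \<open>\<lambda> + \<mu> = 2n\<close>. Setting
  \<open>Z = V = \<xi>\<close> in the hypothesis on \<open>W\<^sub>2\<close>, with \<open>X, Y\<close> in the kernel of \<open>\<eta>\<close>, and applying \<open>\<eta>\<close>, only
  the first term survives and yields \<open>(\<lambda> + 1) (1 - (\<lambda> + 1) / 2n) g(X, Y) = 0\<close>.

  The derivatives of \<open>\<eta>(X)\<close> are avoided by working with the fields \<open>\<nabla>\<^sub>X \<xi>\<close>, which are the
  components of \<open>X\<close> in the kernel of \<open>\<eta>\<close>.\<close>

section \<open>Calculus of smooth maps\<close>

lemma frechet_derivative_eqI:
  "(f has_derivative f') (at x) \<Longrightarrow> frechet_derivative f (at x) v = f' v"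
  using frechet_derivative_at by metis

lemma frechet_derivative_cong_open:
  assumes "open U" "x \<in> U" "\<And>y. y \<in> U \<Longrightarrow> f y = g y"
  shows "frechet_derivative f (at x) = frechet_derivative g (at x)"
proof -
  have "(f has_derivative f') (at x) \<longleftrightarrow> (g has_derivative f') (at x)" for f'
    using has_derivative_transform_within_open[OF _ assms(1,2)] assms(3) by metis
  then show ?thesis by (simp add: frechet_derivative_def)
qed

lemma Ck_on_cong:
  assumes "open U" "\<And>y. y \<in> U \<Longrightarrow> f y = g y"
  shows "Ck_on k U f \<longleftrightarrow> Ck_on k U g"
  using assms(2)
proof (induction k arbitrary: f g)
  case 0
  then show ?case by (auto cong: continuous_on_cong)
next
  case (Suc k)
  have "f differentiable_on U \<longleftrightarrow> g differentiable_on U"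
    unfolding differentiable_on_def using Suc.prems
    by (metis differentiable_transform_within zero_less_one)
  moreover have "Ck_on k U (\<lambda>x. frechet_derivative f (at x) v)
      \<longleftrightarrow> Ck_on k U (\<lambda>x. frechet_derivative g (at x) v)" for v
    by (rule Suc.IH) (simp add: frechet_derivative_cong_open[OF assms(1) _ Suc.prems])
  ultimately show ?case by simp
qed

text \<open>\<open>frechet_derivative\<close> is a choice term. By uniqueness of derivatives any
  explicit formula can replace it on an open set, which is how the sum, product and chain rules
  below are verified.\<close>

lemma Ck_on_Suc_iff:
  assumes "open U"
  shows "Ck_on (Suc k) U f \<longleftrightarrow>
    (\<exists>f'. (\<forall>x\<in>U. (f has_derivative f' x) (at x)) \<and> (\<forall>v. Ck_on k U (\<lambda>x. f' x v)))"
    (is "?L \<longleftrightarrow> ?R")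
proof
  assume ?L
  then have "\<forall>x\<in>U. (f has_derivative frechet_derivative f (at x)) (at x)"
    using assms by (auto simp: differentiable_on_eq_differentiable_at frechet_derivative_works)
  with \<open>?L\<close> show ?R by auto
next
  assume ?R
  then obtain f' where f': "\<And>x. x \<in> U \<Longrightarrow> (f has_derivative f' x) (at x)"
    "\<And>v. Ck_on k U (\<lambda>x. f' x v)" by blast
  have "Ck_on k U (\<lambda>x. frechet_derivative f (at x) v)" for v
    using f'(2)[of v]
      Ck_on_cong[OF assms, of "\<lambda>x. frechet_derivative f (at x) v" "\<lambda>x. f' x v"]
      frechet_derivative_eqI[OF f'(1)] by simp
  moreover have "f differentiable_on U"
    using f'(1) by (meson differentiable_at_imp_differentiable_on differentiableI)
  ultimately show ?L by simp
qed

lemma Ck_on_SucI: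
  assumes "open U" "\<And>x. x \<in> U \<Longrightarrow> (f has_derivative f' x) (at x)"
    "\<And>v. Ck_on k U (\<lambda>x. f' x v)"
  shows "Ck_on (Suc k) U f"
  using assms Ck_on_Suc_iff by blast

lemma Ck_on_Suc_has_derivative:
  assumes "open U" "Ck_on (Suc k) U f" "x \<in> U"
  shows "(f has_derivative frechet_derivative f (at x)) (at x)"
  using assms by (auto simp: differentiable_on_eq_differentiable_at frechet_derivative_works)

lemma Ck_on_imp_continuous_on: "Ck_on k U f \<Longrightarrow> continuous_on U f"
  by (cases k) (auto simp: differentiable_imp_continuous_on)

lemma Ck_on_SucD: "open U \<Longrightarrow> Ck_on (Suc k) U f \<Longrightarrow> Ck_on k U f"
proof (induction k arbitrary: f)
  case 0
  then show ?case using Ck_on_imp_continuous_on by fastforce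
next
  case (Suc k)
  then show ?case by (metis Ck_on.simps(2))
qed

lemma Ck_on_subset:
  "open V \<Longrightarrow> V \<subseteq> U \<Longrightarrow> Ck_on k U f \<Longrightarrow> Ck_on k V f"
  by (induction k arbitrary: f) (auto intro: continuous_on_subset differentiable_on_subset)

text \<open>Derivatives at points of open sets are local. The lemma serves to glue a field given by
  a formula on one open set and by zero on another.\<close>

lemma Ck_on_Un:
  assumes "open U" "open V" "Ck_on k U f" "Ck_on k V f"
  shows "Ck_on k (U \<union> V) f"
  using assms(3,4)
proof (induction k arbitrary: f)
  case 0
  then show ?case using assms continuous_on_open_Un by auto
next
  case (Suc k)
  then show ?case
    using assms by (auto simp: differentiable_on_eq_differentiable_at open_Un)
qed

lemma Ck_on_const: "Ck_on k U (\<lambda>x. c)"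
  by (induction k arbitrary: c) auto

lemma Ck_on_linear:
  assumes "bounded_linear f" "open U"
  shows "Ck_on k U f"
proof (cases k)
  case 0
  then show ?thesis using assms linear_continuous_on by auto
next
  case (Suc j)
  show ?thesis unfolding Suc
    by (rule Ck_on_SucI[where f' = "\<lambda>_. f"])
      (use assms in \<open>auto intro: bounded_linear_imp_has_derivative Ck_on_const\<close>)
qed

lemma Ck_on_linear_compose:
  assumes "bounded_linear L" "open U" "Ck_on k U f"
  shows "Ck_on k U (\<lambda>x. L (f x))"
  using assms(3)
proof (induction k arbitrary: f)
  case 0
  then show ?case using assms(1) bounded_linear.continuous_on by auto
next
  case (Suc k)
  show ?case
  proof (rule Ck_on_SucI[OF assms(2)])
    show "((\<lambda>x. L (f x)) has_derivative (\<lambda>v. L (frechet_derivative f (at x) v))) (at x)"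
      if "x \<in> U" for x
      using bounded_linear.has_derivative[OF assms(1) Ck_on_Suc_has_derivative[OF assms(2) Suc.prems that]] .
    show "Ck_on k U (\<lambda>x. L (frechet_derivative f (at x) v))" for v
      using Suc by simp
  qed
qed

lemma Ck_on_add:
  assumes "open U" "Ck_on k U f" "Ck_on k U g"
  shows "Ck_on k U (\<lambda>x. f x + g x)"
  using assms(2,3)
proof (induction k arbitrary: f g)
  case 0
  then show ?case by (auto intro: continuous_on_add)
next
  case (Suc k)
  show ?case
  proof (rule Ck_on_SucI[OF assms(1)])
    show "((\<lambda>x. f x + g x) has_derivative
        (\<lambda>v. frechet_derivative f (at x) v + frechet_derivative g (at x) v)) (at x)"
      if "x \<in> U" for x
      using Suc.prems that by (intro has_derivative_add Ck_on_Suc_has_derivative[OF assms(1)])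
    show "Ck_on k U (\<lambda>x. frechet_derivative f (at x) v + frechet_derivative g (at x) v)" for v
      using Suc by simp
  qed
qed

lemma Ck_on_sum:
  assumes "open U" "\<And>i. i \<in> I \<Longrightarrow> Ck_on k U (f i)"
  shows "Ck_on k U (\<lambda>x. \<Sum>i\<in>I. f i x)"
  using assms(2)
  by (induction I rule: infinite_finite_induct) (auto intro: Ck_on_const Ck_on_add[OF assms(1)])

lemma Ck_on_bilinear:
  assumes B: "bounded_bilinear B" and "open U" "Ck_on k U f" "Ck_on k U g"
  shows "Ck_on k U (\<lambda>x. B (f x) (g x))"
  using assms(3,4)
proof (induction k arbitrary: f g)
  case 0
  then show ?case using bounded_bilinear.continuous_on[OF B] by auto
next
  case (Suc k)
  \<comment> \<open>The product rule pairs each function with a derivative of the other, so the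
    induction hypothesis meets \<open>f\<close> and \<open>g\<close> with one order of smoothness to
    spare.\<close>
  note fg = Ck_on_SucD[OF assms(2) Suc.prems(1)] Ck_on_SucD[OF assms(2) Suc.prems(2)]
  show ?case
  proof (rule Ck_on_SucI[OF assms(2)])
    show "((\<lambda>x. B (f x) (g x)) has_derivative
        (\<lambda>v. B (f x) (frechet_derivative g (at x) v) + B (frechet_derivative f (at x) v) (g x))) (at x)"
      if "x \<in> U" for x
      using Suc.prems that
      by (intro bounded_bilinear.FDERIV[OF B] Ck_on_Suc_has_derivative[OF assms(2)])
    show "Ck_on k U (\<lambda>x. B (f x) (frechet_derivative g (at x) v) + B (frechet_derivative f (at x) v) (g x))"
      for v
      using Suc.prems by (intro Ck_on_add[OF assms(2)] Suc.IH fg) auto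
  qed
qed

lemma Ck_on_compose:
  fixes f :: "'e::euclidean_space \<Rightarrow> 'f::euclidean_space"
  assumes "open U" "open V" "f ` U \<subseteq> V" "Ck_on k U f" "Ck_on k V g"
  shows "Ck_on k U (\<lambda>x. g (f x))"
  using assms(4,5)
proof (induction k arbitrary: g)
  case 0
  then show ?case using continuous_on_compose2[OF _ _ assms(3)] by auto
next
  case (Suc k)
  let ?Df = "\<lambda>x v. frechet_derivative f (at x) v" and ?Dg = "\<lambda>y v. frechet_derivative g (at y) v"
  show ?case
  proof (rule Ck_on_SucI[OF assms(1)])
    fix x assume x: "x \<in> U"
    have dg: "(g has_derivative ?Dg (f x)) (at (f x))"
      using Ck_on_Suc_has_derivative[OF assms(2) Suc.prems(2)] x assms(3) by auto
    \<comment> \<open>The direction \<open>?Df x v\<close> varies with \<open>x\<close>, while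
      smoothness of \<open>g\<close> concerns fixed directions; expanding in the basis leaves only
      the fixed directions \<open>b\<close>.\<close>
    have expand: "?Dg (f x) w = (\<Sum>b\<in>Basis. (w \<bullet> b) *\<^sub>R ?Dg (f x) b)" for w
    proof -
      interpret linear "?Dg (f x)" using dg has_derivative_linear by blast
      show ?thesis
        by (subst (1) euclidean_representation[of w, symmetric]) (simp add: sum scale)
    qed
    show "((\<lambda>x. g (f x)) has_derivative (\<lambda>v. \<Sum>b\<in>Basis. (?Df x v \<bullet> b) *\<^sub>R ?Dg (f x) b)) (at x)"
      by (rule has_derivative_eq_rhs[OF has_derivative_compose[OF
            Ck_on_Suc_has_derivative[OF assms(1) Suc.prems(1) x] dg]]) (rule ext, rule expand)
  next
    fix v
    have "Ck_on k U (\<lambda>x. ?Dg (f x) b)" for b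
      using Suc.IH[of "\<lambda>y. ?Dg y b"] Suc.prems Ck_on_SucD[OF assms(1)] by auto
    moreover have "Ck_on k U (\<lambda>x. ?Df x v \<bullet> b)" for b
      using Suc.prems(1) by (intro Ck_on_linear_compose[OF bounded_linear_inner_left assms(1)]) auto
    ultimately show "Ck_on k U (\<lambda>x. \<Sum>b\<in>Basis. (?Df x v \<bullet> b) *\<^sub>R ?Dg (f x) b)"
      by (intro Ck_on_sum Ck_on_bilinear[OF bounded_bilinear_scaleR] assms(1))
  qed
qed

section \<open>Flat functions and smooth bump functions\<close>

definition flat_exp :: "nat \<Rightarrow> real \<Rightarrow> real" where
  "flat_exp j t = (if t > 0 then inverse t ^ j * exp (- inverse t) else 0)"

text \<open>The family is closed under differentiation, which makes every member smooth at \<open>0\<close>.\<close>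

lemma has_real_derivative_flat_exp:
  "(flat_exp j has_real_derivative flat_exp (j + 2) t - real j * flat_exp (j + 1) t) (at t)"
proof -
  consider "t > 0" | "t < 0" | "t = 0" by linarith
  then show ?thesis
  proof cases
    case 1
    have "((\<lambda>t. inverse t ^ j * exp (- inverse t)) has_real_derivative
        flat_exp (j + 2) t - real j * flat_exp (j + 1) t) (at t)"
      using 1
      by (auto intro!: derivative_eq_intros simp: flat_exp_def field_simps power2_eq_square)
        (cases j; simp add: field_simps)
    then show ?thesis
      by (rule has_field_derivative_transform_within_open[of _ _ _ "{0<..}"])
        (use 1 in \<open>auto simp: flat_exp_def\<close>)
  next
    case 2
    have "((\<lambda>t. 0) has_real_derivative 0) (at t)" by simp
    then have "(flat_exp j has_real_derivative 0) (at t)"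
      by (rule has_field_derivative_transform_within_open[of _ _ _ "{..<0}"])
        (use 2 in \<open>auto simp: flat_exp_def\<close>)
    then show ?thesis using 2 by (simp add: flat_exp_def)
  next
    case 3
    \<comment> \<open>Since \<open>flat_exp j 0 = 0\<close>, the difference quotient at
      \<open>0\<close> is \<open>flat_exp j h / h\<close>: on the right it has one more power of
      \<open>inverse h\<close>, still beaten by the exponential; on the left it is zero.\<close>
    have "((\<lambda>h. inverse h ^ Suc j * exp (- inverse h)) \<longlongrightarrow> 0) (at_right (0::real))"
      by real_asymp
    moreover have "\<forall>\<^sub>F h in at_right (0::real). inverse h ^ Suc j * exp (- inverse h) = flat_exp j h / h"
      by (auto simp: eventually_at_filter flat_exp_def field_simps)
    ultimately have "((\<lambda>h. flat_exp j h / h) \<longlongrightarrow> 0) (at_right 0)"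
      using tendsto_cong by fast
    moreover have "((\<lambda>h. flat_exp j h / h) \<longlongrightarrow> 0) (at_left 0)"
      by (rule tendsto_eventually) (auto simp: eventually_at_filter flat_exp_def)
    ultimately have "((\<lambda>h. flat_exp j h / h) \<longlongrightarrow> 0) (at 0)"
      by (simp add: filterlim_split_at)
    then show ?thesis using 3 by (simp add: DERIV_def flat_exp_def)
  qed
qed

lemma Ck_on_flat_exp: "Ck_on k UNIV (flat_exp j)"
proof (induction k arbitrary: j)
  case 0
  then show ?case
    using DERIV_isCont[OF has_real_derivative_flat_exp] by (simp add: continuous_on_eq_continuous_at)
next
  case (Suc k)
  show ?case
  proof (rule Ck_on_SucI[OF open_UNIV])
    show "(flat_exp j has_derivative
        (\<lambda>v. (flat_exp (j + 2) t + (- real j) * flat_exp (j + 1) t) * v)) (at t)" for t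
      using has_real_derivative_flat_exp[of j t] by (simp add: has_field_derivative_def)
    have "Ck_on k UNIV (\<lambda>t. flat_exp (j + 2) t + (- real j) * flat_exp (j + 1) t)"
      using Ck_on_add[OF open_UNIV Suc.IH
          Ck_on_linear_compose[OF bounded_linear_mult_right open_UNIV Suc.IH]] .
    then show "Ck_on k UNIV (\<lambda>t. (flat_exp (j + 2) t + (- real j) * flat_exp (j + 1) t) * v)" for v
      by (rule Ck_on_linear_compose[OF bounded_linear_mult_left open_UNIV])
  qed
qed

lemma smooth_bump_function:
  fixes x0 :: "'e::euclidean_space"
  assumes "r > 0"
  obtains b :: "'e \<Rightarrow> real" where "smooth_on UNIV b" "b x0 = 1" "\<And>x. x \<notin> cball x0 r \<Longrightarrow> b x = 0"
proof
  \<comment> \<open>\<open>?q\<close> is positive exactly inside the ball and, being polynomial,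
    smooth at the centre too. Its value \<open>r\<^sup>2\<close> at \<open>x0\<close> explains the
    normalising factor in \<open>?b\<close>.\<close>
  let ?q = "\<lambda>x. r\<^sup>2 - (x - x0) \<bullet> (x - x0)"
  let ?b = "\<lambda>x. inverse (flat_exp 0 (r\<^sup>2)) * flat_exp 0 (?q x)"
  have lin: "Ck_on k UNIV (\<lambda>x. x - x0)" for k
    using Ck_on_add[OF open_UNIV Ck_on_linear[OF bounded_linear_ident open_UNIV, of k] Ck_on_const[of _ _ "- x0"]] by simp
  have "Ck_on k UNIV ?q" for k
    using Ck_on_add[OF open_UNIV Ck_on_const Ck_on_linear_compose[OF bounded_linear_minus[OF bounded_linear_ident]
        open_UNIV Ck_on_bilinear[OF bounded_bilinear_inner open_UNIV lin lin]], of k "r\<^sup>2"] by simp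
  then show "smooth_on UNIV ?b"
    unfolding smooth_on_def
    using Ck_on_linear_compose[OF bounded_linear_mult_right open_UNIV
        Ck_on_compose[OF open_UNIV open_UNIV _ _ Ck_on_flat_exp]] by blast
  show "?b x0 = 1" using assms by (simp add: flat_exp_def)
  show "?b x = 0" if "x \<notin> cball x0 r" for x
  proof -
    have "r < norm (x - x0)" using that by (simp add: dist_norm norm_minus_commute)
    then have "r\<^sup>2 < (norm (x - x0))\<^sup>2" using assms by (intro power_strict_mono) auto
    then show ?thesis by (simp add: flat_exp_def power2_norm_eq_inner)
  qed
qed


section \<open>Vector fields on a smooth manifold\<close>

lemma smooth_on_cong:
  "open U \<Longrightarrow> (\<And>y. y \<in> U \<Longrightarrow> f y = g y) \<Longrightarrow> smooth_on U f \<longleftrightarrow> smooth_on U g"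
  unfolding smooth_on_def using Ck_on_cong by blast

lemma smooth_on_has_derivative:
  "open U \<Longrightarrow> smooth_on U f \<Longrightarrow> x \<in> U \<Longrightarrow>
    (f has_derivative frechet_derivative f (at x)) (at x)"
  unfolding smooth_on_def using Ck_on_Suc_has_derivative by blast

lemma smooth_on_frechet_derivative:
  "smooth_on U f \<Longrightarrow> smooth_on U (\<lambda>x. frechet_derivative f (at x) v)"
  unfolding smooth_on_def by (metis Ck_on.simps(2))

section \<open>Charts, coordinate changes and components of tangent vectors\<close>

locale manifold =
  fixes M :: "'a topology" and A :: "('a, 'm::finite) chart set"
  assumes smooth_manifold: "smooth_manifold M A"
begin

lemma chart: "c \<in> A \<Longrightarrow> is_chart M c"
  using smooth_manifold by (auto simp: smooth_manifold_def)

lemma points_eq: "points A = topspace M"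
  using smooth_manifold by (auto simp: smooth_manifold_def)

lemma points_nonempty: "points A \<noteq> {}"
  using smooth_manifold unfolding smooth_manifold_def by metis

lemma in_points: "c \<in> A \<Longrightarrow> p \<in> fst c \<Longrightarrow> p \<in> points A"
  by (auto simp: points_def)

lemma pref: "p \<in> points A \<Longrightarrow> pref A p \<in> A \<and> p \<in> fst (pref A p)"
  unfolding pref_def points_def by (rule someI_ex) auto

lemma open_chart_range: "c \<in> A \<Longrightarrow> open (chart_range c)"
  using chart by (auto simp: is_chart_def)

lemma inj_on_chart: "c \<in> A \<Longrightarrow> inj_on (snd c) (fst c)"
  using chart[of c] unfolding is_chart_def homeomorphic_eq_everything_map
  by (metis topspace_subtopology_subset openin_subset)

lemma chart_inv_chart [simp]: "c \<in> A \<Longrightarrow> p \<in> fst c \<Longrightarrow> chart_inv c (snd c p) = p"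
  unfolding chart_inv_def by (simp add: inj_on_chart)

lemma chart_chart_inv [simp]: "x \<in> chart_range c \<Longrightarrow> snd c (chart_inv c x) = x"
  unfolding chart_inv_def chart_range_def by (rule f_inv_into_f)

lemma chart_inv_in: "x \<in> chart_range c \<Longrightarrow> chart_inv c x \<in> fst c"
  unfolding chart_inv_def chart_range_def by (rule inv_into_into)

lemma chart_inv_points: "c \<in> A \<Longrightarrow> x \<in> chart_range c \<Longrightarrow> chart_inv c x \<in> points A"
  using chart_inv_in in_points by blast

lemma chart_in_range: "p \<in> fst c \<Longrightarrow> snd c p \<in> chart_range c"
  by (simp add: chart_range_def)

lemma open_chart_image:
  assumes "c \<in> A" "openin M V" "V \<subseteq> fst c"
  shows "open (snd c ` V)"
proof -
  have "open_map (subtopology M (fst c)) (top_of_set (chart_range c)) (snd c)"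
    using chart[OF assms(1)] by (auto simp: is_chart_def intro: homeomorphic_imp_open_map)
  moreover have "openin (subtopology M (fst c)) V"
    using assms by (auto simp: openin_subtopology)
  ultimately show ?thesis
    using open_chart_range[OF assms(1)] openin_open_trans by (auto simp: open_map_def)
qed

lemma openin_chart: "c \<in> A \<Longrightarrow> openin M (fst c)"
  using chart by (auto simp: is_chart_def)

lemma open_overlap: "c \<in> A \<Longrightarrow> c' \<in> A \<Longrightarrow> open (snd c ` (fst c \<inter> fst c'))"
  by (simp add: open_chart_image openin_Int openin_chart)

lemma smooth_transition:
  "c \<in> A \<Longrightarrow> c' \<in> A \<Longrightarrow> smooth_on (snd c ` (fst c \<inter> fst c')) (\<lambda>x. snd c' (chart_inv c x))"
  using smooth_manifold by (auto simp: smooth_manifold_def)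

lemma transition_has_derivative:
  assumes "c \<in> A" "c' \<in> A" "p \<in> fst c" "p \<in> fst c'"
  shows "((\<lambda>x. snd c' (chart_inv c x)) has_derivative
    frechet_derivative (\<lambda>x. snd c' (chart_inv c x)) (at (snd c p))) (at (snd c p))"
  using assms by (intro smooth_on_has_derivative[OF open_overlap smooth_transition]) auto

text \<open>The chain rule for coordinate changes. Tangent vectors are stored in the reference chart
  \<open>pref A p\<close>, and this identity eliminates that arbitrary choice.\<close>

lemma frechet_derivative_transition_compose:
  assumes "c1 \<in> A" "c2 \<in> A" "c3 \<in> A" "p \<in> fst c1" "p \<in> fst c2" "p \<in> fst c3"
  shows "frechet_derivative (\<lambda>x. snd c3 (chart_inv c2 x)) (at (snd c2 p))
      (frechet_derivative (\<lambda>x. snd c2 (chart_inv c1 x)) (at (snd c1 p)) v)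
    = frechet_derivative (\<lambda>x. snd c3 (chart_inv c1 x)) (at (snd c1 p)) v"
proof -
  let ?T = "\<lambda>c c' x. snd c' (chart_inv c x)"
  let ?D = "\<lambda>c c'. frechet_derivative (?T c c') (at (snd c p))"
  have "(?T c2 c3 has_derivative ?D c2 c3) (at (?T c1 c2 (snd c1 p)))"
    using transition_has_derivative[of c2 c3 p] assms by simp
  then have "((\<lambda>x. ?T c2 c3 (?T c1 c2 x)) has_derivative (\<lambda>v. ?D c2 c3 (?D c1 c2 v))) (at (snd c1 p))"
    using has_derivative_compose[OF transition_has_derivative[of c1 c2 p]] assms by blast
  then have "(?T c1 c3 has_derivative (\<lambda>v. ?D c2 c3 (?D c1 c2 v))) (at (snd c1 p))"
    by (rule has_derivative_transform_within_open[OF _ open_overlap[of c1 c2]])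
      (use assms in auto)
  then show ?thesis by (simp add: frechet_derivative_eqI)
qed

lemma frechet_derivative_transition_self:
  assumes "c \<in> A" "p \<in> fst c"
  shows "frechet_derivative (\<lambda>x. snd c (chart_inv c x)) (at (snd c p)) v = v"
proof -
  have "((\<lambda>x. snd c (chart_inv c x)) has_derivative (\<lambda>v. v)) (at (snd c p))"
    by (rule has_derivative_transform_within_open[OF has_derivative_ident open_chart_range])
      (use assms chart_in_range[OF assms(2)] in auto)
  then show ?thesis by (simp add: frechet_derivative_eqI)
qed

lemma mderiv_chart_vector:
  assumes "c \<in> A" "c' \<in> A" "p \<in> fst c" "p \<in> fst c'"
  shows "mderiv A (snd c') p (chart_vector A c p v)
    = frechet_derivative (\<lambda>x. snd c' (chart_inv c x)) (at (snd c p)) v"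
  unfolding mderiv_def chart_vector_def
  using assms pref[OF in_points[OF assms(1,3)]] by (intro frechet_derivative_transition_compose) auto

lemma chart_vector_pref: "p \<in> points A \<Longrightarrow> chart_vector A (pref A p) p v = v"
  using frechet_derivative_transition_self pref by (simp add: chart_vector_def)

lemma linear_mderiv_chart: "c \<in> A \<Longrightarrow> p \<in> fst c \<Longrightarrow> linear (mderiv A (snd c) p)"
  unfolding mderiv_def using pref[OF in_points]
  by (metis transition_has_derivative has_derivative_linear)

text \<open>Functions live on the whole type, but the derivative sees them only through the inverse
  of the reference chart, whose values near the base point lie on the manifold.\<close>

lemma mderiv_cong:
  assumes "p \<in> points A" "\<And>q. q \<in> points A \<Longrightarrow> f q = g q"
  shows "mderiv A f p = mderiv A g p"
proof -
  have "frechet_derivative (\<lambda>x. f (chart_inv (pref A p) x)) (at (snd (pref A p) p))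
    = frechet_derivative (\<lambda>x. g (chart_inv (pref A p) x)) (at (snd (pref A p) p))"
    using pref[OF assms(1)] assms(2)
    by (intro frechet_derivative_cong_open[OF open_chart_range])
      (auto simp: chart_in_range chart_inv_points)
  then show ?thesis by (intro ext) (simp add: mderiv_def)
qed

lemma mderiv_eq_const:
  assumes "p \<in> points A" "\<And>q. q \<in> points A \<Longrightarrow> f q = c"
  shows "mderiv A f p v = 0"
  using mderiv_cong[OF assms(1), of f "\<lambda>_. c"] assms(2) by (simp add: mderiv_def)

section \<open>Smooth functions and vector fields\<close>

lemma smooth_fun_eq_const: "(\<And>p. p \<in> points A \<Longrightarrow> f p = c) \<Longrightarrow> smooth_fun A f"
  unfolding smooth_fun_def
  using smooth_on_cong[OF open_chart_range, of _ "\<lambda>x. f (chart_inv _ x)" "\<lambda>x. c"] chart_inv_points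
  by (auto simp: smooth_on_def Ck_on_const)

lemma vector_field_cong:
  assumes "vector_field A X" "\<And>p. p \<in> points A \<Longrightarrow> X p = Y p"
  shows "vector_field A Y"
  unfolding vector_field_def
proof
  fix c assume c: "c \<in> A"
  have "smooth_on (chart_range c) (\<lambda>x. let p = chart_inv c x in mderiv A (snd c) p (X p))"
    using assms(1) c by (auto simp: vector_field_def)
  then show "smooth_on (chart_range c) (\<lambda>x. let p = chart_inv c x in mderiv A (snd c) p (Y p))"
    by (rule smooth_on_cong[OF open_chart_range[OF c], THEN iffD1, rotated])
      (simp add: Let_def assms(2) chart_inv_points[OF c])
qed

lemma vector_field_add:
  assumes "vector_field A X" "vector_field A Y"
  shows "vector_field A (\<lambda>p. X p + Y p)"
  unfolding vector_field_def
proof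
  fix c assume c: "c \<in> A"
  let ?f = "\<lambda>X x. let p = chart_inv c x in mderiv A (snd c) p (X p)"
  have "smooth_on (chart_range c) (\<lambda>x. ?f X x + ?f Y x)"
    using assms c Ck_on_add[OF open_chart_range[OF c]] unfolding vector_field_def smooth_on_def by blast
  then show "smooth_on (chart_range c) (?f (\<lambda>p. X p + Y p))"
    by (rule smooth_on_cong[OF open_chart_range[OF c], THEN iffD1, rotated])
      (simp add: Let_def linear_add[OF linear_mderiv_chart[OF c]] chart_inv_in)
qed

lemma vector_field_scaleR:
  assumes "vector_field A X"
  shows "vector_field A (\<lambda>p. r *\<^sub>R X p)"
  unfolding vector_field_def
proof
  fix c assume c: "c \<in> A"
  let ?f = "\<lambda>X x. let p = chart_inv c x in mderiv A (snd c) p (X p)"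
  have "smooth_on (chart_range c) (\<lambda>x. r *\<^sub>R ?f X x)"
    using assms c Ck_on_linear_compose[OF bounded_linear_scaleR_right open_chart_range[OF c]]
    unfolding vector_field_def smooth_on_def by blast
  then show "smooth_on (chart_range c) (?f (\<lambda>p. r *\<^sub>R X p))"
    by (rule smooth_on_cong[OF open_chart_range[OF c], THEN iffD1, rotated])
      (simp add: Let_def linear_scale[OF linear_mderiv_chart[OF c]] chart_inv_in)
qed

lemma vector_field_diff:
  "vector_field A X \<Longrightarrow> vector_field A Y \<Longrightarrow> vector_field A (\<lambda>p. X p - Y p)"
  using vector_field_add[OF _ vector_field_scaleR[of Y "- 1"]] by simp

section \<open>Extension of tangent vectors to vector fields\<close>

lemma closedin_chart_preimage_compact:
  assumes "c \<in> A" "compact K" "K \<subseteq> chart_range c"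
  shows "closedin M {p \<in> fst c. snd c p \<in> K}"
proof -
  have hom: "homeomorphic_map (subtopology M (fst c)) (top_of_set (chart_range c)) (snd c)"
    and Haus: "Hausdorff_space M"
    using chart[OF assms(1)] smooth_manifold by (auto simp: is_chart_def smooth_manifold_def)
  have fst: "fst c \<subseteq> topspace M" using openin_subset[OF openin_chart[OF assms(1)]] .
  let ?C = "{p \<in> fst c. snd c p \<in> K}"
  have "snd c ` ?C = K" using assms(3) by (auto simp: chart_range_def)
  moreover have "compactin (top_of_set (chart_range c)) K"
    using assms by (simp add: compactin_subtopology)
  ultimately have "compactin (subtopology M (fst c)) ?C"
    using homeomorphic_map_compactness[OF hom, of ?C] fst by auto
  \<comment> \<open>Compactness in the chart domain is compactness in \<open>M\<close>, and compact
    subsets of a Hausdorff space are closed.\<close>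
  then show ?thesis
    using compactin_imp_closedin[OF Haus] by (auto simp: compactin_subtopology)
qed

text \<open>The field with constant components \<open>v\<close> in one chart is multiplied by a bump
  function and extended by zero. This justifies the choice in \<open>field_through\<close>.\<close>

lemma exists_vector_field_through:
  assumes p0: "p0 \<in> points A"
  shows "\<exists>X. vector_field A X \<and> X p0 = v"
proof -
  define c where "c = pref A p0"
  have c: "c \<in> A" "p0 \<in> fst c" using pref[OF p0] by (auto simp: c_def)
  obtain r where r: "r > 0" "cball (snd c p0) r \<subseteq> chart_range c"
    using open_chart_range[OF c(1)] chart_in_range[OF c(2)] open_contains_cball by blast
  obtain b where b: "smooth_on UNIV b" "b (snd c p0) = (1::real)"
    "\<And>x. x \<notin> cball (snd c p0) r \<Longrightarrow> b x = 0"
    using smooth_bump_function[OF r(1)] by metis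
  define X where "X p = (if p \<in> fst c then b (snd c p) *\<^sub>R chart_vector A c p v else 0)" for p
  define K where "K = {p \<in> fst c. snd c p \<in> cball (snd c p0) r}"
  have K: "closedin M K"
    using closedin_chart_preimage_compact[OF c(1) compact_cball r(2)] by (simp add: K_def)
  have "vector_field A X"
    unfolding vector_field_def
  proof
    fix c' assume c': "c' \<in> A"
    let ?f = "\<lambda>x. let p = chart_inv c' x in mderiv A (snd c') p (X p)"
    let ?T = "\<lambda>x. snd c (chart_inv c' x)"
    let ?G = "\<lambda>y. b y *\<^sub>R frechet_derivative (\<lambda>x. snd c' (chart_inv c x)) (at y) v"
    \<comment> \<open>On \<open>U1\<close> the components of \<open>X\<close> in \<open>c'\<close>
      are \<open>?G\<close> after the coordinate change \<open>?T\<close>; on \<open>U2\<close> they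
      are zero. The two sets cover the chart range because \<open>K\<close> lies in the domain of
      \<open>c\<close>, and \<open>U2\<close> is open because \<open>K\<close> is closed in
      \<open>M\<close>.\<close>
    define U1 U2 where "U1 = snd c' ` (fst c' \<inter> fst c)" and "U2 = snd c' ` (fst c' - K)"
    have U: "open U1" "open U2"
      unfolding U1_def U2_def using c(1) c' K
      by (auto intro!: open_overlap open_chart_image openin_diff openin_chart)
    have "U1 \<union> U2 = chart_range c'" by (auto simp: U1_def U2_def chart_range_def K_def)
    moreover have "Ck_on k U1 ?f" for k
    proof -
      have "Ck_on k (snd c ` (fst c \<inter> fst c')) ?G"
      proof (rule Ck_on_bilinear[OF bounded_bilinear_scaleR open_overlap[OF c(1) c']])
        show "Ck_on k (snd c ` (fst c \<inter> fst c')) b"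
          using b(1) by (intro Ck_on_subset[OF open_overlap[OF c(1) c'] subset_UNIV]) (simp add: smooth_on_def)
        show "Ck_on k (snd c ` (fst c \<inter> fst c'))
            (\<lambda>y. frechet_derivative (\<lambda>x. snd c' (chart_inv c x)) (at y) v)"
          using smooth_on_frechet_derivative[OF smooth_transition[OF c(1) c'], of v]
          by (simp add: smooth_on_def)
      qed
      moreover have "?T ` U1 \<subseteq> snd c ` (fst c \<inter> fst c')" using c' by (auto simp: U1_def)
      moreover have "Ck_on k U1 ?T"
        using smooth_transition[OF c' c(1)] by (simp add: U1_def smooth_on_def)
      ultimately have "Ck_on k U1 (\<lambda>x. ?G (?T x))"
        using Ck_on_compose[OF U(1) open_overlap[OF c(1) c'], of ?T k ?G] by blast
      moreover have "?f x = ?G (?T x)" if "x \<in> U1" for x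
        using that c c'
        by (auto simp: U1_def X_def Let_def mderiv_chart_vector linear_scale[OF linear_mderiv_chart])
      ultimately show ?thesis
        using Ck_on_cong[OF U(1), of ?f "\<lambda>x. ?G (?T x)" k] by blast
    qed
    moreover have "Ck_on k U2 ?f" for k
    proof -
      have "?f x = 0" if "x \<in> U2" for x
      proof -
        obtain q where q: "q \<in> fst c'" "q \<notin> K" "x = snd c' q"
          using \<open>x \<in> U2\<close> by (auto simp: U2_def)
        then have "X q = 0" using b(3)[of "snd c q"] by (auto simp: X_def K_def)
        then show ?thesis using q c' linear_0[OF linear_mderiv_chart[OF c' q(1)]] by (simp add: Let_def)
      qed
      then show ?thesis using Ck_on_cong[OF U(2), of ?f "\<lambda>_. 0" k] Ck_on_const by blast
    qed
    ultimately show "smooth_on (chart_range c') ?f"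
      using Ck_on_Un[OF U, of _ ?f] by (simp add: smooth_on_def)
  qed
  moreover have "X p0 = v"
    using c b(2) chart_vector_pref[OF p0] by (simp add: X_def c_def)
  ultimately show ?thesis by blast
qed

lemma field_through:
  assumes "p \<in> points A"
  shows "vector_field A (field_through A p v)" "field_through A p v p = v"
  using someI_ex[OF exists_vector_field_through[OF assms, of v]] by (auto simp: field_through_def)

end


section \<open>Para-Kenmotsu manifolds and eta-Ricci solitons\<close>

text \<open>Pairing \<open>u\<close> with a vector \<open>e j\<close> of the orthonormal basis
  isolates the coefficient at \<open>e j\<close> up to sign, so every coefficient vanishes.\<close>

lemma has_signature_nondegenerate:
  fixes b :: "'v::real_vector \<Rightarrow> 'v \<Rightarrow> real"
  assumes "bilinear b" "has_signature b r s" "\<And>w. b u w = 0"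
  shows "u = 0"
proof -
  obtain e where e: "span (e ` {..<r + s}) = UNIV"
    "\<And>i j. i < r + s \<Longrightarrow> j < r + s \<Longrightarrow> b (e i) (e j) = (if i \<noteq> j then 0 else if i < r then 1 else - 1)"
    using assms(2) unfolding has_signature_def by blast
  let ?E = "e ` {..<r + s}"
  have "u \<in> span ?E" using e(1) by simp
  then obtain c where c: "u = (\<Sum>v\<in>?E. c v *\<^sub>R v)"
    by (subst (asm) span_finite) auto
  have lin: "linear (\<lambda>v. b v w)" for w
    using assms(1) by (simp add: bilinear_def)
  have "c (e j) = 0" if j: "j < r + s" for j
  proof -
    have "0 = (\<Sum>v\<in>?E. c v * b v (e j))"
      using assms(3)[of "e j"] unfolding c
      by (simp add: linear_sum[OF lin] linear_scale[OF lin])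
    also have "\<dots> = (\<Sum>v\<in>{e j}. c v * b v (e j))"
    proof (rule sum.mono_neutral_right)
      show "\<forall>v\<in>?E - {e j}. c v * b v (e j) = 0"
        using e(2)[OF _ j] by auto (metis (full_types))
    qed (use j in auto)
    finally show ?thesis using e(2)[OF j j] by (auto split: if_splits)
  qed
  then show ?thesis unfolding c by (auto intro!: sum.neutral)
qed

section \<open>Rules for affine connections\<close>

locale manifold_connection = manifold M A
  for M :: "'a topology" and A :: "('a, 'm::finite) chart set" +
  fixes D :: "('a, 'm) connection"
  assumes affine: "affine_connection A D"
begin

lemma vector_field_D [intro]: "vector_field A X \<Longrightarrow> vector_field A Y \<Longrightarrow> vector_field A (D X Y)"
  using affine by (auto simp: affine_connection_def)

lemma D_add_right:
  "vector_field A X \<Longrightarrow> vector_field A Y \<Longrightarrow> vector_field A Y' \<Longrightarrow> p \<in> points A \<Longrightarrow>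
    D X (\<lambda>q. Y q + Y' q) p = D X Y p + D X Y' p"
  using affine by (auto simp: affine_connection_def)

lemma D_leibniz:
  "smooth_fun A f \<Longrightarrow> vector_field A X \<Longrightarrow> vector_field A Y \<Longrightarrow> p \<in> points A \<Longrightarrow>
    D X (\<lambda>q. f q *\<^sub>R Y q) p = mderiv A f p (X p) *\<^sub>R Y p + f p *\<^sub>R D X Y p"
  using affine by (auto simp: affine_connection_def)

lemma D_scaleR_right:
  assumes "vector_field A X" "vector_field A Y" "p \<in> points A"
  shows "D X (\<lambda>q. r *\<^sub>R Y q) p = r *\<^sub>R D X Y p"
proof -
  have "smooth_fun A (\<lambda>_. r)" by (rule smooth_fun_eq_const) simp
  then have "D X (\<lambda>q. r *\<^sub>R Y q) p = mderiv A (\<lambda>_. r) p (X p) *\<^sub>R Y p + r *\<^sub>R D X Y p"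
    using D_leibniz assms by blast
  then show ?thesis using mderiv_eq_const[OF assms(3), of "\<lambda>_. r" r] by simp
qed

lemma D_diff_right:
  assumes "vector_field A X" "vector_field A Y" "vector_field A Y'" "p \<in> points A"
  shows "D X (\<lambda>q. Y q - Y' q) p = D X Y p - D X Y' p"
  using D_add_right[OF assms(1,2) vector_field_scaleR[OF assms(3), of "- 1"] assms(4)]
    D_scaleR_right[OF assms(1,3,4), of "- 1"] by simp

text \<open>A field vanishing on the manifold equals its product with the indicator function of the
  complement, which is smooth because smoothness only concerns values on the manifold.\<close>

lemma D_zero_right:
  assumes "vector_field A X" "vector_field A Y" "p \<in> points A" "\<And>q. q \<in> points A \<Longrightarrow> Y q = 0"
  shows "D X Y p = 0"
proof -
  let ?f = "\<lambda>q. if q \<in> points A then 0 else 1 :: real"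
  have "smooth_fun A ?f" by (rule smooth_fun_eq_const) simp
  then have "D X (\<lambda>q. ?f q *\<^sub>R Y q) p = mderiv A ?f p (X p) *\<^sub>R Y p + ?f p *\<^sub>R D X Y p"
    by (rule D_leibniz[OF _ assms(1-3)])
  moreover have "(\<lambda>q. ?f q *\<^sub>R Y q) = Y" using assms(4) by auto
  ultimately show ?thesis using assms(3,4) by simp
qed

end

section \<open>Structure equations of a para-Kenmotsu manifold\<close>

locale para_kenmotsu_manifold = manifold M A
  for M :: "'a topology" and A :: "('a, 'm::finite) chart set" +
  fixes n :: nat
    and \<phi> :: "'a \<Rightarrow> real ^ 'm \<Rightarrow> real ^ 'm"
    and \<xi> :: "('a, 'm) vfield"
    and \<eta> :: "'a \<Rightarrow> real ^ 'm \<Rightarrow> real"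
    and g :: "('a, 'm) bilinear_field"
    and D :: "('a, 'm) connection"
  assumes n: "n \<ge> 1" and dim: "CARD('m) = 2 * n + 1"
    and levi_civita: "levi_civita_connection A g D"
    and para_kenmotsu: "para_kenmotsu n A \<phi> \<xi> \<eta> g D"
begin

sublocale manifold_connection M A D
  using levi_civita by unfold_locales (simp add: levi_civita_connection_def)

lemma almost_paracontact_metric: "almost_paracontact_metric n A \<phi> \<xi> \<eta> g"
  using para_kenmotsu by (simp add: para_kenmotsu_def)

lemma vector_field_xi [intro]: "vector_field A \<xi>"
  using almost_paracontact_metric by (simp add: almost_paracontact_metric_def)

lemma linear_eta: "p \<in> points A \<Longrightarrow> linear (\<eta> p)"
  using almost_paracontact_metric by (simp add: almost_paracontact_metric_def one_form_def)

lemma linear_phi: "p \<in> points A \<Longrightarrow> linear (\<phi> p)"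
  using almost_paracontact_metric by (simp add: almost_paracontact_metric_def endomorphism_field_def)

lemma bilinear_g: "p \<in> points A \<Longrightarrow> bilinear (g p)"
  using almost_paracontact_metric
  by (simp add: almost_paracontact_metric_def pseudo_riemannian_metric_def smooth_bilinear_field_def)

lemma g_commute: "p \<in> points A \<Longrightarrow> g p v w = g p w v"
  using almost_paracontact_metric
  by (simp add: almost_paracontact_metric_def pseudo_riemannian_metric_def)

lemma g_nondegenerate: "p \<in> points A \<Longrightarrow> (\<And>w. g p u w = 0) \<Longrightarrow> u = 0"
  using almost_paracontact_metric has_signature_nondegenerate[OF bilinear_g, of p "n + 1" n u]
  by (simp add: almost_paracontact_metric_def pseudo_riemannian_metric_def)

lemma structure_identities:
  assumes "p \<in> points A"
  shows phi_xi: "\<phi> p (\<xi> p) = 0" and eta_phi: "\<eta> p (\<phi> p v) = 0"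
    and eta_xi: "\<eta> p (\<xi> p) = 1" and phi_phi: "\<phi> p (\<phi> p v) = v - \<eta> p v *\<^sub>R \<xi> p"
    and paracomplex: "almost_paracomplex n {v. \<eta> p v = 0} (\<phi> p)"
  using almost_paracontact_metric assms by (simp_all add: almost_paracontact_metric_def)

lemmas tensor_simps =
  linear_add[OF linear_eta] linear_diff[OF linear_eta] linear_scale[OF linear_eta]
  linear_neg[OF linear_eta] linear_0[OF linear_eta]
  linear_add[OF linear_phi] linear_diff[OF linear_phi] linear_scale[OF linear_phi]
  linear_neg[OF linear_phi] linear_0[OF linear_phi]
  bilinear_ladd[OF bilinear_g] bilinear_lsub[OF bilinear_g] bilinear_lmul[OF bilinear_g]
  bilinear_lneg[OF bilinear_g] bilinear_lzero[OF bilinear_g]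
  bilinear_radd[OF bilinear_g] bilinear_rsub[OF bilinear_g] bilinear_rmul[OF bilinear_g]
  bilinear_rneg[OF bilinear_g] bilinear_rzero[OF bilinear_g]
  phi_xi eta_phi eta_xi phi_phi

lemma g_phi_phi:
  "vector_field A X \<Longrightarrow> vector_field A Y \<Longrightarrow> p \<in> points A \<Longrightarrow>
    g p (\<phi> p (X p)) (\<phi> p (Y p)) = - g p (X p) (Y p) + \<eta> p (X p) * \<eta> p (Y p)"
  using almost_paracontact_metric by (simp add: almost_paracontact_metric_def)

text \<open>In the compatibility condition with second field \<xi> the left side vanishes by
  \<open>\<phi> \<xi> = 0\<close>. The condition speaks of vector fields, so \<open>v\<close> is
  first extended to one.\<close>

lemma g_xi_right: "p \<in> points A \<Longrightarrow> g p v (\<xi> p) = \<eta> p v"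
  using g_phi_phi[OF field_through(1)[of p v] vector_field_xi, of p]
  by (simp add: field_through(2) tensor_simps)

lemma g_xi_left: "p \<in> points A \<Longrightarrow> g p (\<xi> p) v = \<eta> p v"
  using g_xi_right g_commute by simp

lemmas metric_simps = tensor_simps g_xi_right g_xi_left

lemma D_phi:
  "vector_field A X \<Longrightarrow> vector_field A Y \<Longrightarrow> p \<in> points A \<Longrightarrow>
    D X (\<lambda>q. \<phi> q (Y q)) p - \<phi> p (D X Y p) =
      g p (\<phi> p (X p)) (Y p) *\<^sub>R \<xi> p - \<eta> p (Y p) *\<^sub>R \<phi> p (X p)"
  using para_kenmotsu by (simp add: para_kenmotsu_def)

lemma lie_bracket_eq:
  "vector_field A X \<Longrightarrow> vector_field A Y \<Longrightarrow> p \<in> points A \<Longrightarrow>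
    lie_bracket A X Y p = D X Y p - D Y X p"
  using levi_civita by (simp add: levi_civita_connection_def)

text \<open>By zero torsion the bracket agrees on the manifold with a difference of covariant
  derivatives and inherits their smoothness.\<close>

lemma vector_field_lie_bracket [intro]:
  "vector_field A X \<Longrightarrow> vector_field A Y \<Longrightarrow> vector_field A (lie_bracket A X Y)"
  using vector_field_cong[OF vector_field_diff] lie_bracket_eq vector_field_D by metis

lemma mderiv_g:
  "vector_field A X \<Longrightarrow> vector_field A Y \<Longrightarrow> vector_field A Z \<Longrightarrow> p \<in> points A \<Longrightarrow>
    mderiv A (\<lambda>q. g q (Y q) (Z q)) p (X p) = g p (D X Y p) (Z p) + g p (Y p) (D X Z p)"
  using levi_civita by (simp add: levi_civita_connection_def)

text \<open>Metric compatibility for a constant inner product. With \<xi> as one of the fields it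
  gives \<eta>-components of covariant derivatives without differentiating \<eta>.\<close>

lemma g_D_const:
  assumes "vector_field A X" "vector_field A Y" "vector_field A Z" "p \<in> points A"
    "\<And>q. q \<in> points A \<Longrightarrow> g q (Y q) (Z q) = c"
  shows "g p (D X Y p) (Z p) = - g p (Y p) (D X Z p)"
  using mderiv_g[OF assms(1-4)] mderiv_eq_const[OF assms(4,5)] by simp

lemma vector_field_zero: "(\<And>q. q \<in> points A \<Longrightarrow> X q = 0) \<Longrightarrow> vector_field A X"
  using vector_field_cong[OF vector_field_scaleR[OF vector_field_xi, of 0]] by simp

text \<open>With \<open>Y = \<xi>\<close> the para-Kenmotsu equation gives
  \<open>\<phi> (D X \<xi>) = \<phi> X\<close>, which fixes \<open>D X \<xi>\<close> up to a
  multiple of \<xi>; constancy of \<open>g(\<xi>, \<xi>)\<close> makes its \<xi>-component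
  zero.\<close>

lemma D_xi:
  assumes X: "vector_field A X" and p: "p \<in> points A"
  shows "D X \<xi> p = X p - \<eta> p (X p) *\<^sub>R \<xi> p"
proof -
  have "D X (\<lambda>q. \<phi> q (\<xi> q)) p = 0"
    by (rule D_zero_right[OF X vector_field_zero p]) (simp_all add: phi_xi)
  then have "\<phi> p (D X \<xi> p) = \<phi> p (X p)"
    using D_phi[OF X vector_field_xi p] p by (simp add: metric_simps)
  then have "D X \<xi> p - \<eta> p (D X \<xi> p) *\<^sub>R \<xi> p = X p - \<eta> p (X p) *\<^sub>R \<xi> p"
    using phi_phi[OF p] by metis
  moreover have "\<eta> p (D X \<xi> p) = 0"
    using g_D_const[OF X vector_field_xi vector_field_xi p, of 1] p by (simp add: metric_simps)
  ultimately show ?thesis by simp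
qed

lemma vector_field_horizontal_part: "vector_field A X \<Longrightarrow> vector_field A (D X \<xi>)"
  by blast

lemma eta_D_xi: "vector_field A X \<Longrightarrow> p \<in> points A \<Longrightarrow> \<eta> p (D X \<xi> p) = 0"
  by (simp add: D_xi metric_simps)

text \<open>Zero torsion and compatibility turn the Lie derivative into
  \<open>g(D X \<xi>, Y) + g(X, D Y \<xi>)\<close>.\<close>

lemma lie_derivative_metric:
  assumes "vector_field A X" "vector_field A Y" "p \<in> points A"
  shows "lie_derivative_bilinear A \<xi> g X Y p = 2 * (g p (X p) (Y p) - \<eta> p (X p) * \<eta> p (Y p))"
  using assms mderiv_g[OF vector_field_xi assms]
  by (simp add: lie_derivative_bilinear_def lie_bracket_eq vector_field_xi D_xi metric_simps algebra_simps)

text \<open>Differentiation along \<xi> preserves the splitting into the kernel of \<eta> and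
  multiples of \<xi>, so \<open>D \<xi> (D X \<xi>)\<close> is the component of
  \<open>D \<xi> X\<close> in that kernel. The other terms come from \<open>D_xi\<close>.\<close>

lemma curvature_xi_xi:
  assumes X: "vector_field A X" and p: "p \<in> points A"
  shows "curvature A D X \<xi> \<xi> p = \<eta> p (X p) *\<^sub>R \<xi> p - X p"
proof -
  note V = X vector_field_xi vector_field_horizontal_part
  \<comment> \<open>\<open>K\<close> is \<open>\<eta>(X) \<xi>\<close>, written as a difference of
    two fields known to be smooth.\<close>
  define K where "K q = X q - D X \<xi> q" for q
  have K: "vector_field A K" unfolding K_def by (intro vector_field_diff V)
  have Kq: "K q = \<eta> q (X q) *\<^sub>R \<xi> q" if "q \<in> points A" for q
    using that X by (simp add: K_def D_xi)
  \<comment> \<open>As \<open>\<phi> K = 0\<close>, the para-Kenmotsu equation in direction \<xi>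
    gives \<open>\<phi> (D \<xi> K) = 0\<close>; applying \<phi> once more makes
    \<open>D \<xi> K\<close> a multiple of \<xi>.\<close>
  have "D \<xi> (\<lambda>q. \<phi> q (K q)) p = 0"
    by (rule D_zero_right[OF vector_field_xi vector_field_zero p]) (simp_all add: Kq metric_simps)
  then have "\<phi> p (D \<xi> K p) = 0"
    using D_phi[OF vector_field_xi K p] p by (simp add: metric_simps)
  then have "D \<xi> K p = \<eta> p (D \<xi> K p) *\<^sub>R \<xi> p"
    using phi_phi[OF p, of "D \<xi> K p"] p by (simp add: metric_simps)
  moreover have DK: "D \<xi> K p = D \<xi> X p - D \<xi> (D X \<xi>) p"
    unfolding K_def by (rule D_diff_right) (use V p in auto)
  moreover have "\<eta> p (D \<xi> (D X \<xi>) p) = 0"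
    using g_D_const[OF vector_field_xi vector_field_horizontal_part[OF X] vector_field_xi p, of 0] p X
    by (simp add: metric_simps D_xi vector_field_xi)
  ultimately have "D \<xi> (D X \<xi>) p = D \<xi> X p - \<eta> p (D \<xi> X p) *\<^sub>R \<xi> p"
    using p by (simp add: metric_simps algebra_simps)
  moreover have "D X (D \<xi> \<xi>) p = 0"
    by (rule D_zero_right) (use V p in \<open>auto simp: D_xi eta_xi\<close>)
  moreover have "D (lie_bracket A X \<xi>) \<xi> p
      = D X \<xi> p - D \<xi> X p + \<eta> p (D \<xi> X p) *\<^sub>R \<xi> p"
    using V p by (simp add: D_xi vector_field_lie_bracket lie_bracket_eq metric_simps)
  ultimately have "curvature A D X \<xi> \<xi> p = - D X \<xi> p" by (simp add: curvature_def)
  then show ?thesis using X p by (simp add: D_xi)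
qed

text \<open>The trace is that of \<open>v \<mapsto> \<eta>(v) \<xi> - v\<close>: the rank-one part
  contributes \<open>\<eta>(\<xi>) = 1\<close>, the identity the dimension
  \<open>2n + 1\<close>.\<close>

lemma ricci_xi_xi:
  assumes p: "p \<in> points A"
  shows "ricci A D \<xi> \<xi> p = - 2 * real n"
proof -
  have "(\<lambda>v. curvature A D (field_through A p v) \<xi> \<xi> p) = (\<lambda>v. \<eta> p v *\<^sub>R \<xi> p - v)"
    using field_through[OF p] p by (simp add: curvature_xi_xi)
  then have "ricci A D \<xi> \<xi> p = (\<Sum>i\<in>UNIV. \<eta> p (axis i 1) * \<xi> p $ i - 1)"
    by (simp add: ricci_def trace_def matrix_def axis_def)
  also have "\<dots> = (\<Sum>i\<in>UNIV. \<eta> p ((\<xi> p $ i) *\<^sub>R axis i 1)) - real CARD('m)"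
    using p by (simp add: sum_subtractf metric_simps mult.commute)
  also have "(\<Sum>i\<in>UNIV. \<eta> p ((\<xi> p $ i) *\<^sub>R axis i 1)) = \<eta> p (\<xi> p)"
    using basis_expansion[of "\<xi> p"]
    by (simp add: linear_sum[OF linear_eta[OF p], symmetric] scalar_mult_eq_scaleR)
  finally show ?thesis using p dim by (simp add: metric_simps)
qed

section \<open>Horizontal fields and the \<eta>-component of the curvature\<close>

definition horizontal :: "('a, 'm) vfield \<Rightarrow> bool" where
  "horizontal X \<longleftrightarrow> vector_field A X \<and> (\<forall>q\<in>points A. \<eta> q (X q) = 0)"

lemma horizontalD:
  "horizontal X \<Longrightarrow> vector_field A X"
  "horizontal X \<Longrightarrow> p \<in> points A \<Longrightarrow> \<eta> p (X p) = 0"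
  by (auto simp: horizontal_def)

text \<open>By \<open>D_xi\<close>, \<open>X \<mapsto> D X \<xi>\<close> is the pointwise projection
  onto the kernel of \<eta>; applied to any extension of \<open>v\<close> it keeps the value at
  \<open>p\<close>.\<close>

lemma exists_horizontal:
  assumes p: "p \<in> points A" and v: "\<eta> p v = 0"
  obtains X where "horizontal X" "X p = v"
proof
  show "horizontal (D (field_through A p v) \<xi>)"
    using field_through[OF p] by (auto simp: horizontal_def eta_D_xi)
  show "D (field_through A p v) \<xi> p = v"
    using field_through[OF p] p v by (simp add: D_xi)
qed

text \<open>This differentiates \<open>g(X, \<xi>) = 0\<close> along \<open>Z\<close>; the
  \<xi>-component of \<open>D Z \<xi>\<close> is orthogonal to \<open>X\<close>.\<close>

lemma eta_D_horizontal:
  assumes X: "horizontal X" and Z: "vector_field A Z" and p: "p \<in> points A"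
  shows "\<eta> p (D Z X p) = - g p (X p) (Z p)"
  using g_D_const[OF Z horizontalD(1)[OF X] vector_field_xi p, of 0] Z p
  by (simp add: metric_simps D_xi horizontalD[OF X])

text \<open>Second derivatives are handled by differentiating inner products with \<xi>. In the
  first claim they cancel by symmetry of \<open>g\<close>, and the bracket term is killed by
  \<open>eta_D_xi\<close>.\<close>

lemma eta_curvature_horizontal:
  assumes X: "horizontal X" and Y: "horizontal Y" and p: "p \<in> points A"
  shows "\<eta> p (curvature A D Y X \<xi> p) = 0" (is ?R1)
    and "\<eta> p (curvature A D Y \<xi> X p) = g p (X p) (Y p)" (is ?R2)
proof -
  note V = horizontalD(1)[OF X] horizontalD(1)[OF Y] vector_field_xi
  have "\<eta> p (D Y (D X \<xi>) p) = - g p (X p) (Y p)" "\<eta> p (D X (D Y \<xi>) p) = - g p (Y p) (X p)"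
    using eta_D_horizontal[of "D X \<xi>" Y p] eta_D_horizontal[of "D Y \<xi>" X p] X Y V p
    by (auto simp: horizontal_def eta_D_xi D_xi)
  then show ?R1
    using V p g_commute[OF p]
    by (simp add: curvature_def metric_simps eta_D_xi vector_field_lie_bracket)
  \<comment> \<open>\<open>D \<xi> X\<close> is again horizontal, as its \<eta>-component is
    \<open>- g(X, \<xi>) = 0\<close>, so its inner product with \<xi> is constant.\<close>
  have g1: "g p (D Y (D \<xi> X) p) (\<xi> p) = - g p (D \<xi> X p) (Y p)"
    using g_D_const[of Y "D \<xi> X" \<xi> p 0] X Y V p
    by (simp add: metric_simps eta_D_horizontal D_xi horizontalD[OF X] horizontalD[OF Y] vector_field_D)
  have neg: "vector_field A (\<lambda>q. - X q)" "D \<xi> (\<lambda>q. - X q) p = - D \<xi> X p"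
    using vector_field_scaleR[OF V(1), of "- 1"] D_scaleR_right[OF V(3,1) p, of "- 1"] by simp_all
  \<comment> \<open>The two sides below are the derivatives along \<open>\<xi>\<close> of the equal functions
    \<open>g(\<nabla>\<^sub>Y X, \<xi>)\<close> and \<open>g(-X, Y)\<close>.\<close>
  have "g p (D \<xi> (D Y X) p) (\<xi> p) + g p (D Y X p) (D \<xi> \<xi> p)
      = g p (D \<xi> (\<lambda>q. - X q) p) (Y p) + g p (- X p) (D \<xi> Y p)"
    using mderiv_g[OF V(3) vector_field_D[OF V(2,1)] V(3) p] mderiv_g[OF V(3) neg(1) V(2) p]
      mderiv_cong[OF p, of "\<lambda>q. g q (D Y X q) (\<xi> q)" "\<lambda>q. g q (- X q) (Y q)"] X V
    by (simp add: metric_simps eta_D_horizontal)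
  then have g2: "g p (D \<xi> (D Y X) p) (\<xi> p) = - g p (D \<xi> X p) (Y p) - g p (X p) (D \<xi> Y p)"
    using p V by (simp add: neg metric_simps D_xi)
  \<comment> \<open>The bracket is \<open>Y - D \<xi> Y\<close> because \<open>Y\<close> is
    horizontal. Together with \<open>g1\<close> and \<open>g2\<close> all derivatives along \<xi>
    cancel, leaving \<open>g(X, Y)\<close>.\<close>
  have "\<eta> p (D (lie_bracket A Y \<xi>) X p) = - g p (X p) (Y p - D \<xi> Y p)"
    using X Y V p by (simp add: eta_D_horizontal vector_field_lie_bracket lie_bracket_eq D_xi horizontalD[OF Y])
  then show ?R2
    using g1 g2 p by (simp add: curvature_def metric_simps)
qed

lemma exists_horizontal_pair:
  assumes p: "p \<in> points A"
  obtains X Y where "horizontal X" "horizontal Y" "g p (X p) (Y p) \<noteq> 0"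
proof -
  \<comment> \<open>As \<open>n \<ge> 1\<close>, the eigenspace for \<open>1\<close> inside the
    kernel of \<eta> is nonzero.\<close>
  have "dim {v \<in> {v. \<eta> p v = 0}. \<phi> p v = v} \<noteq> 0"
    using paracomplex[OF p] n by (simp add: almost_paracomplex_def)
  then obtain v where v: "\<eta> p v = 0" "v \<noteq> 0"
    unfolding dim_eq_0 by blast
  then obtain w where w: "g p v w \<noteq> 0" using g_nondegenerate[OF p] by blast
  obtain X where X: "horizontal X" "X p = v" using exists_horizontal[OF p v(1)] .
  \<comment> \<open>Removing the \<xi>-component of \<open>w\<close> leaves \<open>g p v w\<close>
    unchanged because \<open>\<eta> p v = 0\<close>.\<close>
  have "\<eta> p (w - \<eta> p w *\<^sub>R \<xi> p) = 0" using p by (simp add: metric_simps)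
  then obtain Y where Y: "horizontal Y" "Y p = w - \<eta> p w *\<^sub>R \<xi> p"
    using exists_horizontal[OF p] by blast
  show ?thesis using that[OF X(1) Y(1)] X Y v w p by (simp add: metric_simps)
qed

end

section \<open>Ricci tensor and \<open>W\<^sub>2\<close> curvature of an \<eta>-Ricci
  soliton\<close>

locale para_kenmotsu_soliton = para_kenmotsu_manifold M A n \<phi> \<xi> \<eta> g D
  for M :: "'a topology" and A :: "('a, 'm::finite) chart set" and n \<phi> \<xi> \<eta> g D +
  fixes lam \<mu> :: real
  assumes soliton: "eta_ricci_soliton A \<eta> D g \<xi> lam \<mu>"
begin

lemma ricci_eq:
  assumes "vector_field A X" "vector_field A Y" "p \<in> points A"
  shows "ricci A D X Y p = - (lam + 1) * g p (X p) (Y p) - (\<mu> - 1) * (\<eta> p (X p) * \<eta> p (Y p))"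
proof -
  have "lie_derivative_bilinear A \<xi> g X Y p + 2 * ricci A D X Y p +
      2 * lam * g p (X p) (Y p) + 2 * \<mu> * (\<eta> p (X p) * \<eta> p (Y p)) = 0"
    using soliton assms unfolding eta_ricci_soliton_def by blast
  then show ?thesis unfolding lie_derivative_metric[OF assms] by argo
qed

lemma lam_plus_mu: "lam + \<mu> = 2 * real n"
proof -
  obtain p where p: "p \<in> points A"
    using points_nonempty by blast
  show ?thesis
    using ricci_xi_xi[OF p] ricci_eq[OF vector_field_xi vector_field_xi p] p by (simp add: metric_simps)
qed

lemma ricci_operator_eq:
  assumes X: "vector_field A X" and p: "p \<in> points A"
  shows "ricci_operator A g D X p = - (lam + 1) *\<^sub>R X p - ((\<mu> - 1) * \<eta> p (X p)) *\<^sub>R \<xi> p"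
    (is "_ = ?w")
  unfolding ricci_operator_def
proof (rule the_equality)
  show w: "\<forall>Y. vector_field A Y \<longrightarrow> g p ?w (Y p) = ricci A D X Y p"
    using p X by (simp add: ricci_eq metric_simps)
  \<comment> \<open>The defining property tests only vector fields; extending each tangent vector
    \<open>v\<close> to a field makes nondegeneracy of \<open>g\<close> applicable.\<close>
  fix w assume "\<forall>Y. vector_field A Y \<longrightarrow> g p w (Y p) = ricci A D X Y p"
  then have "g p (w - ?w) v = 0" for v
    using w field_through[OF p, of v] p by (metis bilinear_lsub[OF bilinear_g] right_minus_eq)
  then show "w = ?w" using g_nondegenerate[OF p] by (metis right_minus_eq)
qed

text \<open>The curvature contributes \<open>- Y\<close>, the term with \<open>Q \<xi>\<close> drops
  since \<open>g(Y, \<xi>) = 0\<close>, and \<open>- Q Y / 2n\<close> gives the rest.\<close>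

lemma W2_horizontal_xi_xi:
  assumes Y: "horizontal Y" and p: "p \<in> points A"
  shows "W2_curvature n A g D Y \<xi> \<xi> p = ((lam + 1) / (2 * real n) - 1) *\<^sub>R Y p"
  using Y p vector_field_xi
  by (simp add: W2_curvature_def curvature_xi_xi ricci_operator_eq horizontalD[OF Y] metric_simps algebra_simps add_divide_distrib)

lemma eta_W2_horizontal:
  assumes X: "horizontal X" and Y: "horizontal Y" and p: "p \<in> points A"
  shows "\<eta> p (W2_curvature n A g D Y X \<xi> p) = 0"
    and "\<eta> p (W2_curvature n A g D Y \<xi> X p) = 0"
proof -
  \<comment> \<open>This is where \<open>lam + \<mu> = 2n\<close> enters: divided by
    \<open>2n\<close>, the term \<open>g(Y, X) Q \<xi>\<close> cancels exactly the curvature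
    contribution \<open>g(X, Y)\<close>.\<close>
  have "ricci_operator A g D \<xi> p = - (2 * real n) *\<^sub>R \<xi> p"
    using p vector_field_xi lam_plus_mu[symmetric]
    by (simp add: ricci_operator_eq metric_simps algebra_simps)
  then show "\<eta> p (W2_curvature n A g D Y \<xi> X p) = 0"
    using X Y p n g_commute[OF p, of "Y p"]
    by (simp add: W2_curvature_def eta_curvature_horizontal ricci_operator_eq horizontalD[OF X] horizontalD[OF Y] metric_simps)
  show "\<eta> p (W2_curvature n A g D Y X \<xi> p) = 0"
    using X Y p by (simp add: W2_curvature_def eta_curvature_horizontal horizontalD[OF X] horizontalD[OF Y] metric_simps)
qed

lemma lam_alternative:
  defines "S \<equiv> ricci A D" and "W \<equiv> W2_curvature n A g D"
  assumes sym: "\<And>X Y Z V p. vector_field A X \<Longrightarrow> vector_field A Y \<Longrightarrow> vector_field A Z \<Longrightarrow>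
           vector_field A V \<Longrightarrow> p \<in> points A \<Longrightarrow>
             S X (W Y Z V) p *\<^sub>R \<xi> p - S \<xi> (W Y Z V) p *\<^sub>R X p +
             S X Y p *\<^sub>R W \<xi> Z V p - S \<xi> Y p *\<^sub>R W X Z V p +
             S X Z p *\<^sub>R W Y \<xi> V p - S \<xi> Z p *\<^sub>R W Y X V p +
             S X V p *\<^sub>R W Y Z \<xi> p - S \<xi> V p *\<^sub>R W Y Z X p = 0"
  shows "lam = - 1 \<or> lam = 2 * real n - 1"
proof -
  obtain p where p: "p \<in> points A"
    using points_nonempty by blast
  obtain X Y where XY: "horizontal X" "horizontal Y" "g p (X p) (Y p) \<noteq> 0"
    using exists_horizontal_pair[OF p] .
  note V = horizontalD(1)[OF XY(1)] horizontalD(1)[OF XY(2)] vector_field_xi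
  let ?b = "(lam + 1) / (2 * real n) - 1"
  \<comment> \<open>\<open>ricci_eq\<close> expects vector fields; on the manifold this one is a
    constant multiple of \<open>Y\<close>.\<close>
  have W: "vector_field A (W Y \<xi> \<xi>)"
    using vector_field_cong[OF vector_field_scaleR[OF V(2)]] W2_horizontal_xi_xi[OF XY(2)]
    unfolding W_def by metis
  have S: "S X (W Y \<xi> \<xi>) p = - (lam + 1) * ?b * g p (X p) (Y p)" "S \<xi> (W Y \<xi> \<xi>) p = 0"
    "S \<xi> Y p = 0" "S X \<xi> p = 0"
    using V W p XY
    by (simp_all add: S_def ricci_eq W_def W2_horizontal_xi_xi horizontalD[OF XY(1)] horizontalD[OF XY(2)] metric_simps)
  have "W \<xi> \<xi> \<xi> p = 0"
    using V p by (simp add: W_def W2_curvature_def curvature_xi_xi eta_xi)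
  \<comment> \<open>With \<open>Z = V = \<xi>\<close> the zero coefficients in \<open>S\<close> and
    \<open>W \<xi> \<xi> \<xi> p = 0\<close> leave three terms, of which \<eta> annihilates the two
    with factor \<open>S \<xi> \<xi> p\<close> by \<open>eta_W2_horizontal\<close>.\<close>
  then have "\<eta> p (S X (W Y \<xi> \<xi>) p *\<^sub>R \<xi> p - S \<xi> \<xi> p *\<^sub>R W Y X \<xi> p - S \<xi> \<xi> p *\<^sub>R W Y \<xi> X p) = 0"
    using sym[OF V V(3) p] S p by (simp add: linear_0[OF linear_eta])
  then have "S X (W Y \<xi> \<xi>) p = 0"
    using p eta_W2_horizontal[OF XY(1,2) p] by (simp add: W_def metric_simps)
  then have "- (lam + 1) * ?b * g p (X p) (Y p) = 0" by (simp only: S(1))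
  then have "- (lam + 1) = 0 \<or> ?b = 0" using XY(3) unfolding mult_eq_0_iff by blast
  then show ?thesis using n by (auto simp: field_simps)
qed

end

theorem theorem3p14:
  fixes M :: "'a topology" and A :: "('a, 'm::finite) chart set"
    and n :: nat
    and \<phi> :: "'a \<Rightarrow> real ^ 'm \<Rightarrow> real ^ 'm"
    and \<xi> :: "('a, 'm) vfield"
    and \<eta> :: "'a \<Rightarrow> real ^ 'm \<Rightarrow> real"
    and g :: "('a, 'm) bilinear_field"
    and D :: "('a, 'm) connection"
    and lam \<mu> :: real
    and S :: "('a, 'm) vfield \<Rightarrow> ('a, 'm) vfield \<Rightarrow> 'a \<Rightarrow> real"
    and W :: "('a, 'm) vfield \<Rightarrow> ('a, 'm) vfield \<Rightarrow> ('a, 'm) vfield \<Rightarrow> ('a, 'm) vfield"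
  assumes "n \<ge> 1" and "CARD('m) = 2 * n + 1"
    and "smooth_manifold M A"
    and "levi_civita_connection A g D"
    and "para_kenmotsu n A \<phi> \<xi> \<eta> g D"
    and "eta_ricci_soliton A \<eta> D g \<xi> lam \<mu>"
    and "S = ricci A D" and "W = W2_curvature n A g D"
    and "\<And>X Y Z V p. vector_field A X \<Longrightarrow> vector_field A Y \<Longrightarrow> vector_field A Z \<Longrightarrow>
           vector_field A V \<Longrightarrow> p \<in> topspace M \<Longrightarrow>
             S X (W Y Z V) p *\<^sub>R \<xi> p - S \<xi> (W Y Z V) p *\<^sub>R X p +
             S X Y p *\<^sub>R W \<xi> Z V p - S \<xi> Y p *\<^sub>R W X Z V p +
             S X Z p *\<^sub>R W Y \<xi> V p - S \<xi> Z p *\<^sub>R W Y X V p +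
             S X V p *\<^sub>R W Y Z \<xi> p - S \<xi> V p *\<^sub>R W Y Z X p = 0"
  shows "(\<mu> = 1 \<and> lam = 2 * real n - 1) \<or> (\<mu> = 2 * real n + 1 \<and> lam = - 1)"
proof -
  interpret para_kenmotsu_soliton M A n \<phi> \<xi> \<eta> g D lam \<mu>
    using assms(1-6) by unfold_locales
  have "lam = - 1 \<or> lam = 2 * real n - 1"
    using lam_alternative assms(9) unfolding assms(7,8) points_eq by blast
  then show ?thesis using lam_plus_mu by auto
qed

end
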